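(* Let $F/K$ be a field extension. Let $Q(X)\in K[X]$ be monic of degree $h$, and let $S=\{x_1,\dots,x_n\}\subset F$ be a set of $n$ distinct elements such that $Q(a)\neq 0$ for all $a\in S$. Let $1\le \mu\le n$ be such that $k:=\mu-h\geq 1$. Let $f(X)\in K[X]$ with $\deg f(X)<\mu$. Then there exists a subset $A\subset S$ with $|A|=\mu$ such that $$\prod_{a\in A}(X-a)\equiv f(X)\bmod Q(X)\qquad(\ast)$$ (congruence in $F[X]$) if and only if the word $$y=\operatorname{ev}_S\left(-\frac{f(X)}{Q(X)}-X^k\right)=\left(-\frac{f(x_i)}{Q(x_i)}-x_i^k\right)_{1\le i\le n}\in F^n$$ is exactly at distance $n-\mu$ from the Reed-Solomon code $C_k$ of dimension $k$ and support $S$ over $F$. Moreover, all the sets $A\subset S$ with $|A|=\mu$ satisfying $(\ast)$ can be found by decoding $y$ up to the radius $n-\mu$; that is, every such $A$ is of the form $\{x_i : r(x_i)=y_i\}$ for some $r(X)$ in the decoding output $F_{n-\mu}(y)$.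
   Context: For a finite set $S=\{x_1,\dots,x_n\}\subset F$ of $n$ distinct elements, the evaluation map $\operatorname{ev}_S$ sends a polynomial $r(X)\in F[X]$ (or a rational function without poles on $S$) to $(r(x_1),\dots,r(x_n))\in F^n$. For $1\le k\le n$ the Reed-Solomon code over $F$ with support $S$ and dimension $k$ is $C_k=\{\operatorname{ev}_S(r(X)) : r(X)\in F[X],\ \deg r(X)<k\}\subset F^n$. The (Hamming) distance of $y,z\in F^n$ is $d(y,z)=|\{i : y_i\neq z_i\}|$; the distance from $y$ to $C_k$ is $\min_{c\in C_k} d(y,c)$. Decoding $y$ up to radius $\tau$ means computing the set $F_\tau(y)=\{r(X)\in F[X] : \deg r(X)<k,\ d(\operatorname{ev}_S(r(X)),y)\le\tau\}$. *)

theory Defs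
  imports "HOL-Computational_Algebra.Polynomial" "HOL-Number_Theory.Cong"
begin

text \<open>
  A field extension \<open>F/K\<close> is rendered by a field type \<open>'f\<close> for \<open>F\<close> and a subfield \<open>K\<close> of it
  given as a set; \<open>K[X]\<close> is then the set of polynomials of \<open>F[X]\<close> with coefficients in \<open>K\<close>.
\<close>

definition is_subfield :: "'f::field set \<Rightarrow> bool" where
  "is_subfield K \<longleftrightarrow> 0 \<in> K \<and> 1 \<in> K \<and>
     (\<forall>a\<in>K. \<forall>b\<in>K. a + b \<in> K \<and> a * b \<in> K) \<and>
     (\<forall>a\<in>K. - a \<in> K \<and> inverse a \<in> K)"

definition polys_over :: "'f::field set \<Rightarrow> 'f poly set" where
  "polys_over K = {p. \<forall>i. coeff p i \<in> K}"

text \<open>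
  The support \<open>S = {x\<^sub>1, \<dots>, x\<^sub>n}\<close> is given by the list \<open>xs\<close> of its elements without repetitions, and
  words of \<open>F\<^sup>n\<close> are lists of length \<open>n\<close>, indexed from \<open>0\<close>. Evaluation takes a function on \<open>F\<close>, so
  that it covers both polynomial functions \<open>poly r\<close> and rational functions without poles on \<open>S\<close>.
\<close>

definition ev :: "'f list \<Rightarrow> ('f \<Rightarrow> 'f) \<Rightarrow> 'f list" where
  "ev xs g = map g xs"

text \<open>
  Since \<open>degree 0 = 0\<close>, the condition \<open>degree r < k\<close> admits \<open>r = 0\<close> for \<open>k \<ge> 1\<close>, the only case in
  which the next definition and that of \<open>decode\<close> are meant.
\<close>

definition RS_code :: "'f::field list \<Rightarrow> nat \<Rightarrow> 'f list set" where
  "RS_code xs k = {ev xs (poly r) | r. degree r < k}"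

definition hamming_dist :: "'f list \<Rightarrow> 'f list \<Rightarrow> nat" where
  "hamming_dist y z = card {i. i < length y \<and> y ! i \<noteq> z ! i}"

text \<open>
  The code may be infinite, but the set of distances is bounded by \<open>length y\<close>, so \<open>Min\<close> is the
  minimum whenever the code is nonempty.
\<close>

definition dist_to_code :: "'f list \<Rightarrow> 'f list set \<Rightarrow> nat" where
  "dist_to_code y C = Min (hamming_dist y ` C)"

text \<open>The set \<open>F\<^sub>\<tau>(y)\<close> computed by decoding \<open>y\<close> up to radius \<open>\<tau>\<close>.\<close>

definition decode :: "'f::field list \<Rightarrow> nat \<Rightarrow> nat \<Rightarrow> 'f list \<Rightarrow> 'f poly set" where
  "decode xs k \<tau> y = {r. degree r < k \<and> hamming_dist (ev xs (poly r)) y \<le> \<tau>}"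

end

theory Submission
  imports Defs
begin

text \<open>
  Send a polynomial \<open>r\<close> of degree less than \<open>k\<close> to its locator \<open>f + Q (X\<^sup>k + r)\<close>, which is
  congruent to \<open>f\<close> modulo \<open>Q\<close> and, because \<open>deg f < \<mu> = h + k\<close>, monic of degree \<open>\<mu>\<close>.
  Division by \<open>Q\<close> shows that every monic polynomial of degree \<open>\<mu>\<close> in the residue class of \<open>f\<close>
  arises in this way (\<open>monic_cong_imp_locator\<close>).

  Dividing by \<open>Q(a) \<noteq> 0\<close>, the locator vanishes at a point \<open>a\<close> of the support exactly when \<open>r(a)\<close> is
  the value \<open>-f(a)/Q(a) - a\<^sup>k\<close> of the word \<open>y\<close> (\<open>poly_locator_eq_0_iff\<close>). So \<open>r\<close> and \<open>y\<close> agree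
  exactly at the roots of the locator in \<open>S\<close>. There are at most \<open>\<mu>\<close> of them, so no codeword is
  closer to \<open>y\<close> than \<open>n - \<mu>\<close>; and there are \<open>\<mu>\<close> of them, forming a set \<open>A\<close>, precisely when the
  locator is \<open>\<Prod>\<^bsub>a\<in>A\<^esub> (X - a)\<close>. Hence the sets \<open>A\<close> with the congruence are the agreement sets of
  the codewords at distance \<open>n - \<mu>\<close>, which gives both claims.
\<close>

lemma hamming_dist_ev:
  assumes "distinct xs"
  shows "hamming_dist (ev xs u) (ev xs w) = length xs - card {a \<in> set xs. u a = w a}"
proof -
  let ?D = "{a \<in> set xs. u a \<noteq> w a}"
  have "hamming_dist (ev xs u) (ev xs w) = card {i. i < length xs \<and> u (xs ! i) \<noteq> w (xs ! i)}"
    unfolding hamming_dist_def ev_def by (rule arg_cong[where f = card]) auto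
  also have "\<dots> = card ((!) xs ` {i. i < length xs \<and> u (xs ! i) \<noteq> w (xs ! i)})"
    using assms by (intro card_image[symmetric] inj_on_nth) auto
  also have "(!) xs ` {i. i < length xs \<and> u (xs ! i) \<noteq> w (xs ! i)} = ?D"
    by (auto simp: in_set_conv_nth)
  also have "?D = set xs - {a \<in> set xs. u a = w a}" by auto
  also have "card \<dots> = length xs - card {a \<in> set xs. u a = w a}"
    using assms by (subst card_Diff_subset) (auto simp: distinct_card)
  finally show ?thesis .
qed

text \<open>
  The distances to a code are bounded by the length of the word, so the minimum is attained even for
  an infinite code.
\<close>
lemma dist_to_code_eq_iff:
  assumes "C \<noteq> {}" and lower: "\<And>c. c \<in> C \<Longrightarrow> d \<le> hamming_dist y c"
  shows "dist_to_code y C = d \<longleftrightarrow> (\<exists>c\<in>C. hamming_dist y c = d)"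
proof -
  have "hamming_dist y c \<le> length y" for c
  proof -
    have "hamming_dist y c \<le> card {..<length y}"
      unfolding hamming_dist_def by (rule card_mono) auto
    then show ?thesis by simp
  qed
  then have fin: "finite (hamming_dist y ` C)"
    using finite_subset[of "hamming_dist y ` C" "{..length y}"] by auto
  show ?thesis
    unfolding dist_to_code_def using Min_eq_iff[OF fin] assms by auto
qed

lemma lead_coeff_prod_linear: "lead_coeff (\<Prod>a\<in>A. [:- a, 1:] :: 'a::idom poly) = 1"
  by (simp add: lead_coeff_prod)

lemma degree_prod_linear: "degree (\<Prod>a\<in>A. [:- a, 1:] :: 'a::idom poly) = card A"
  by (simp add: degree_prod_sum_eq)

lemma monic_eq_prod_roots:
  fixes p :: "'a::idom poly"
  assumes "finite A" and "lead_coeff p = 1" and "degree p = card A"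
    and "\<And>a. a \<in> A \<Longrightarrow> poly p a = 0"
  shows "p = (\<Prod>a\<in>A. [:- a, 1:])"
proof (rule poly_eqI_degree_lead_coeff[where n = "card A" and A = A])
  show "coeff p (card A) = coeff (\<Prod>a\<in>A. [:- a, 1:]) (card A)"
    using assms lead_coeff_prod_linear[of A] by (simp add: degree_prod_linear)
qed (use assms in \<open>auto simp: degree_prod_linear poly_prod\<close>)

text \<open>
  Away from the roots of \<open>Q\<close>, the roots of this polynomial locate the points at which \<open>r\<close> agrees
  with the rational function \<open>-f/Q - X\<^sup>k\<close>.
\<close>
definition locator :: "'a::field poly \<Rightarrow> 'a poly \<Rightarrow> nat \<Rightarrow> 'a poly \<Rightarrow> 'a poly" where
  "locator Q f k r = f + Q * (monom 1 k + r)"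

lemma locator_cong: "[locator Q f k r = f] (mod Q)"
  by (simp add: locator_def cong_iff_dvd_diff)

lemma poly_locator_eq_0_iff:
  assumes "poly Q a \<noteq> 0"
  shows "poly (locator Q f k r) a = 0 \<longleftrightarrow> poly r a = - (poly f a / poly Q a) - a ^ k"
proof -
  have "poly (locator Q f k r) a
      = poly Q a * (poly r a - (- (poly f a / poly Q a) - a ^ k))"
    using assms by (simp add: locator_def poly_monom algebra_simps)
  then show ?thesis using assms by simp
qed

lemma locator_monic:
  fixes Q f r :: "'a::field poly"
  assumes "lead_coeff Q = 1" and "degree f < degree Q + k" and "degree r < k"
  shows "degree (locator Q f k r) = degree Q + k" and "lead_coeff (locator Q f k r) = 1"
proof -
  let ?c = "monom 1 k + r"
  have deg_c: "degree ?c = k"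
    using assms(3) by (simp add: degree_add_eq_left degree_monom_eq)
  then have lc_c: "lead_coeff ?c = 1"
    using assms(3) by (simp add: coeff_eq_0)
  then have "Q \<noteq> 0" "?c \<noteq> 0"
    using assms(1) by (metis leading_coeff_0_iff zero_neq_one)+
  then have deg: "degree (Q * ?c) = degree Q + k"
    by (simp add: degree_mult_eq deg_c)
  then show "degree (locator Q f k r) = degree Q + k"
    unfolding locator_def using assms(2) by (simp add: degree_add_eq_right)
  show "lead_coeff (locator Q f k r) = 1"
  proof -
    have "lead_coeff (Q * ?c) = 1"
      using assms(1) lc_c by (simp only: lead_coeff_mult mult_1)
    then show ?thesis
      unfolding locator_def using assms(2) deg by (subst lead_coeff_add_le) simp_all
  qed
qed

text \<open>
  The cofactor of \<open>Q\<close> in \<open>p - f\<close> is monic of degree \<open>k\<close>, like \<open>X\<^sup>k\<close>, so the two differ by a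
  polynomial of degree less than \<open>k\<close>.
\<close>
lemma monic_cong_imp_locator:
  fixes Q f p :: "'a::field poly"
  assumes "lead_coeff Q = 1" and "degree f < degree Q + k" and "0 < k"
    and "lead_coeff p = 1" and "degree p = degree Q + k" and "[p = f] (mod Q)"
  obtains r where "degree r < k" and "p = locator Q f k r"
proof -
  obtain c where c: "p - f = Q * c"
    using assms(6) by (auto simp: cong_iff_dvd_diff)
  have deg: "degree (p - f) = degree Q + k"
    using assms(2,5) degree_add_eq_left[of "- f" p] by simp
  have "lead_coeff (p - f) = 1"
    unfolding deg using assms(2,4,5) by (simp add: coeff_eq_0)
  then have lc_c: "lead_coeff c = 1"
    unfolding c lead_coeff_mult using assms(1) by simp
  then have "Q \<noteq> 0" "c \<noteq> 0" using assms(1) by auto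
  then have deg_c: "degree c = k"
    using deg by (simp add: c degree_mult_eq)
  have "degree (c - monom 1 k) \<le> k"
    by (rule degree_diff_le) (simp_all add: deg_c degree_monom_le)
  moreover have "coeff (c - monom 1 k) k = 0"
    using lc_c by (simp add: deg_c)
  ultimately have "degree (c - monom 1 k) < k"
    using eq_zero_or_degree_less \<open>0 < k\<close> by fastforce
  moreover have "p = locator Q f k (c - monom 1 k)"
    using c by (simp add: locator_def algebra_simps)
  ultimately show thesis by (rule that)
qed

theorem theorem2:
  fixes K :: "'f::field set" and Q f :: "'f poly" and xs y :: "'f list" and S :: "'f set"
    and h n \<mu> k :: nat
  assumes "is_subfield K"
    and "Q \<in> polys_over K" and "lead_coeff Q = 1" and "degree Q = h"
    and "distinct xs" and "length xs = n" and "S = set xs"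
    and "\<forall>a\<in>S. poly Q a \<noteq> 0"
    and "1 \<le> \<mu>" and "\<mu> \<le> n"
    and "k = \<mu> - h" and "1 \<le> k"
    and "f \<in> polys_over K" and "degree f < \<mu>"
    and "y = ev xs (\<lambda>a. - (poly f a / poly Q a) - a ^ k)"
  shows "((\<exists>A\<subseteq>S. card A = \<mu> \<and> [(\<Prod>a\<in>A. [:- a, 1:]) = f] (mod Q))
           \<longleftrightarrow> dist_to_code y (RS_code xs k) = n - \<mu>) \<and>
         (\<forall>A\<subseteq>S. card A = \<mu> \<and> [(\<Prod>a\<in>A. [:- a, 1:]) = f] (mod Q) \<longrightarrow>
           (\<exists>r\<in>decode xs k (n - \<mu>) y. A = {xs ! i | i. i < n \<and> poly r (xs ! i) = y ! i}))"
proof -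
  define w where "w = (\<lambda>a. - (poly f a / poly Q a) - a ^ k)"
  define agree where "agree r = {a \<in> S. poly r a = w a}" for r
  have y: "y = ev xs w" using assms(15) by (simp add: w_def)
  have finS: "finite S" and cardS: "card S = n"
    using \<open>distinct xs\<close> \<open>length xs = n\<close> \<open>S = set xs\<close> by (simp_all add: distinct_card)
  have mu: "\<mu> = degree Q + k"
    using \<open>degree Q = h\<close> \<open>k = \<mu> - h\<close> \<open>1 \<le> k\<close> by simp
  have deg_f: "degree f < degree Q + k" using \<open>degree f < \<mu>\<close> mu by simp

  have agree_roots: "agree r = {a \<in> S. poly (locator Q f k r) a = 0}" for r
    using \<open>\<forall>a\<in>S. poly Q a \<noteq> 0\<close> by (auto simp: agree_def w_def poly_locator_eq_0_iff)
  have agree_le: "card (agree r) \<le> \<mu>" if "degree r < k" for r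
  proof -
    note monic = locator_monic[OF \<open>lead_coeff Q = 1\<close> deg_f that]
    then have "locator Q f k r \<noteq> 0" by auto
    then have "card (agree r) \<le> degree (locator Q f k r)"
      unfolding agree_roots
      by (intro order.trans[OF card_mono card_poly_roots_bound] poly_roots_finite) auto
    then show ?thesis using monic(1) mu by simp
  qed
  have agree_cong: "[(\<Prod>a\<in>agree r. [:- a, 1:]) = f] (mod Q)"
    if "degree r < k" "card (agree r) = \<mu>" for r
  proof -
    have "locator Q f k r = (\<Prod>a\<in>agree r. [:- a, 1:])"
      using locator_monic[OF \<open>lead_coeff Q = 1\<close> deg_f \<open>degree r < k\<close>] that(2) finS mu
      by (intro monic_eq_prod_roots) (simp_all add: agree_roots)
    then show ?thesis using locator_cong by metis
  qed
  have cong_agree: "\<exists>r. degree r < k \<and> A = agree r"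
    if A: "A \<subseteq> S" "card A = \<mu>" "[(\<Prod>a\<in>A. [:- a, 1:]) = f] (mod Q)" for A
  proof -
    obtain r where r: "degree r < k" "(\<Prod>a\<in>A. [:- a, 1:]) = locator Q f k r"
      using monic_cong_imp_locator[OF \<open>lead_coeff Q = 1\<close> deg_f _ lead_coeff_prod_linear _ A(3)]
        \<open>1 \<le> k\<close> A(2) mu by (auto simp: degree_prod_linear)
    have "finite A" using A(1) finS finite_subset by blast
    then have "A = agree r"
      unfolding agree_roots r(2)[symmetric] using A(1) by (auto simp: poly_prod)
    with r(1) show ?thesis by blast
  qed

  have dist: "hamming_dist y (ev xs (poly r)) = n - card (agree r)"
    and dist': "hamming_dist (ev xs (poly r)) y = n - card (agree r)" for r
    using \<open>distinct xs\<close> \<open>length xs = n\<close> \<open>S = set xs\<close>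
    by (simp_all add: y hamming_dist_ev agree_def eq_commute[of "w _"])
  have "RS_code xs k \<noteq> {}"
    using \<open>1 \<le> k\<close> by (auto simp: RS_code_def intro!: exI[of _ 0])
  moreover have "n - \<mu> \<le> hamming_dist y c" if "c \<in> RS_code xs k" for c
    using that agree_le by (auto simp: RS_code_def dist intro!: diff_le_mono2)
  ultimately have "dist_to_code y (RS_code xs k) = n - \<mu>
      \<longleftrightarrow> (\<exists>c\<in>RS_code xs k. hamming_dist y c = n - \<mu>)"
    by (rule dist_to_code_eq_iff)
  also have "\<dots> \<longleftrightarrow> (\<exists>r. degree r < k \<and> n - card (agree r) = n - \<mu>)"
    by (auto simp: RS_code_def dist)
  \<comment> \<open>Both subtrahends are at most \<open>n\<close>, so the truncated differences determine them.\<close>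
  also have "\<dots> \<longleftrightarrow> (\<exists>r. degree r < k \<and> card (agree r) = \<mu>)"
    using agree_le \<open>\<mu> \<le> n\<close> by (metis diff_diff_cancel le_trans)
  also have "\<dots> \<longleftrightarrow> (\<exists>A\<subseteq>S. card A = \<mu> \<and> [(\<Prod>a\<in>A. [:- a, 1:]) = f] (mod Q))"
    using agree_cong cong_agree by (metis (no_types, lifting) agree_def mem_Collect_eq subsetI)
  finally have iff: "dist_to_code y (RS_code xs k) = n - \<mu>
      \<longleftrightarrow> (\<exists>A\<subseteq>S. card A = \<mu> \<and> [(\<Prod>a\<in>A. [:- a, 1:]) = f] (mod Q))" .

  have agree_nth: "agree r = {xs ! i | i. i < n \<and> poly r (xs ! i) = y ! i}" for r
    using \<open>length xs = n\<close> \<open>S = set xs\<close>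
    by (auto simp: agree_def y ev_def in_set_conv_nth)
  have "\<exists>r\<in>decode xs k (n - \<mu>) y. A = {xs ! i | i. i < n \<and> poly r (xs ! i) = y ! i}"
    if A: "A \<subseteq> S" "card A = \<mu>" "[(\<Prod>a\<in>A. [:- a, 1:]) = f] (mod Q)" for A
  proof -
    obtain r where r: "degree r < k" "A = agree r" using cong_agree[OF A] by blast
    then have "r \<in> decode xs k (n - \<mu>) y" using A(2) by (simp add: decode_def dist')
    with r(2) show ?thesis unfolding agree_nth by blast
  qed
  with iff show ?thesis by blast
qed

end
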